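(* Let $n\ge 1$. For every region $R$ of the hyperplane arrangement $\mathcal{K}_{2n}$ there is exactly one permutation $\pi\in\mathfrak{G}^{\mathrm{I}}_{2n}$ that is compatible with $R$, and the resulting map $\Lambda^{\mathrm{I}}:\mathcal{R}(\mathcal{K}_{2n})\to\mathfrak{G}^{\mathrm{I}}_{2n}$, $R\mapsto\pi$, is a bijection. In particular the regions of $\mathcal{K}_{2n}$ are in bijection with $\mathfrak{G}^{\mathrm{I}}_{2n}$.
   Context: For $n\ge1$, $\mathcal{K}_{2n}$ is the arrangement in $\mathbb{R}^{2n+1}=\{(x_1,\dots,x_{2n+1})\}$ consisting of the hyperplanes $x_{2i-1}-x_{2j}=0$ for all $1\le i\le j\le n$. Its regions are the connected components of the complement of the union of these hyperplanes; $\mathcal{R}(\mathcal{K}_{2n})$ denotes the set of regions. A permutation $\pi=\pi_1\cdots\pi_{2n}$ of $[2n]=\{1,\dots,2n\}$ (one-line notation, $\pi_i=\pi(i)$) is compatible with a region $R$ if for every pair $(i,j)$ with $i<j$, $i$ odd and $j$ even, and every $\mathbf{x}\in R$, one has $\pi^{-1}(i)<\pi^{-1}(j)$ if and only if $x_i<x_j$. $\mathfrak{G}^{\mathrm{I}}_{2n}$ is the set of permutations $\pi$ of $[2n]$ such that every ascent $\pi_i<\pi_{i+1}$ has $\pi_i$ odd and $\pi_{i+1}$ even. *)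

theory Defs
  imports
    "HOL-Analysis.Analysis"
    "HOL-Combinatorics.Permutations"
    "HOL-Library.Equipollence"
begin

text \<open>
  The space \<open>\<real>\<^sup>2\<^sup>n\<^sup>+\<^sup>1\<close> is carried by the extensional functions on \<open>{1..2n+1}\<close> (coordinates
  are numbered from 1) with the product topology, so that \<open>n\<close> can be a term-level parameter.
\<close>

definition ambient :: "nat \<Rightarrow> (nat \<Rightarrow> real) topology"
  where "ambient n = product_topology (\<lambda>_. euclideanreal) {1..2 * n + 1}"

definition hyperplane :: "nat \<Rightarrow> nat \<Rightarrow> nat \<Rightarrow> (nat \<Rightarrow> real) set"
  where "hyperplane n a b = {x \<in> topspace (ambient n). x a - x b = 0}"

definition arrangement :: "nat \<Rightarrow> (nat \<Rightarrow> real) set set"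
  where "arrangement n = {hyperplane n (2 * i - 1) (2 * j) | i j. 1 \<le> i \<and> i \<le> j \<and> j \<le> n}"

definition regions :: "nat \<Rightarrow> (nat \<Rightarrow> real) set set"
  where "regions n =
    connected_components_of
      (subtopology (ambient n) (topspace (ambient n) - \<Union> (arrangement n)))"

text \<open>
  A permutation of \<open>{1..2n}\<close> is a function \<open>\<pi>\<close> with \<open>\<pi> permutes {1..2 * n}\<close>; the letter
  \<open>\<pi>\<^sub>i\<close> of its one-line notation is \<open>\<pi> i\<close>.
\<close>

definition compatible :: "nat \<Rightarrow> (nat \<Rightarrow> nat) \<Rightarrow> (nat \<Rightarrow> real) set \<Rightarrow> bool"
  where "compatible n \<pi> R \<longleftrightarrow>
    (\<forall>i\<in>{1..2 * n}. \<forall>j\<in>{1..2 * n}. i < j \<and> odd i \<and> even j \<longrightarrow>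
      (\<forall>x\<in>R. inv \<pi> i < inv \<pi> j \<longleftrightarrow> x i < x j))"

definition G_I :: "nat \<Rightarrow> (nat \<Rightarrow> nat) set"
  where "G_I n = {\<pi>. \<pi> permutes {1..2 * n} \<and>
    (\<forall>i\<in>{1..<2 * n}. \<pi> i < \<pi> (i + 1) \<longrightarrow> odd (\<pi> i) \<and> even (\<pi> (i + 1)))}"

definition Lambda_I :: "nat \<Rightarrow> (nat \<Rightarrow> real) set \<Rightarrow> nat \<Rightarrow> nat"
  where "Lambda_I n R = (THE \<pi>. \<pi> \<in> G_I n \<and> compatible n \<pi> R)"

end

theory Submission
  imports Defs
begin

text \<open>
  A region of the arrangement is an acyclic orientation of the graph whose edges join each odd
  \<open>i\<close> to each even \<open>j > i\<close>, and the permutations compatible with it are the linear extensions.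
  Exchanging adjacent letters that form no edge preserves compatibility. Existence: among the
  compatible permutations, one that minimises \<open>\<Sum>k. k * \<pi> k\<close> has no ascent that could be
  exchanged, so it lies in \<open>G_I\<close>. Uniqueness: at the first position where two such permutations
  differ, the smaller letter of the one is followed later by the larger letter \<open>b\<close> of the other,
  and \<open>b\<close> forms no edge with any letter in between. The last of these letters below \<open>b\<close> is
  followed by a letter \<open>\<ge> b\<close>, so that ascent goes from odd to even, and, whatever its parity,
  \<open>b\<close> forms an edge with one of its two ends.
\<close>

section \<open>Permutations compatible with a point\<close>

text \<open>The pairs tested by \<open>compatible\<close>; by \<open>arrangement_eq\<close> they
  also index the hyperplanes.\<close>

definition edge :: "nat \<Rightarrow> nat \<Rightarrow> nat \<Rightarrow> bool"
  where "edge n i j \<longleftrightarrow> 1 \<le> i \<and> i < j \<and> j \<le> 2 * n \<and> odd i \<and> even j"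

text \<open>Compatibility at one point, which by \<open>compatible_region_iff\<close> decides it for
  the whole region.\<close>

definition agrees :: "nat \<Rightarrow> (nat \<Rightarrow> nat) \<Rightarrow> (nat \<Rightarrow> real) \<Rightarrow> bool"
  where "agrees n \<pi> x \<longleftrightarrow> (\<forall>i j. edge n i j \<longrightarrow> (inv \<pi> i < inv \<pi> j \<longleftrightarrow> x i < x j))"

lemma compatible_iff_agrees: "compatible n \<pi> R \<longleftrightarrow> (\<forall>x\<in>R. agrees n \<pi> x)"
proof
  assume c: "compatible n \<pi> R"
  show "\<forall>x\<in>R. agrees n \<pi> x"
    unfolding agrees_def
  proof (intro ballI allI impI)
    fix x i j assume "x \<in> R" "edge n i j"
    then show "inv \<pi> i < inv \<pi> j \<longleftrightarrow> x i < x j"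
      using c unfolding compatible_def edge_def by (auto dest!: bspec[of _ _ i] bspec[of _ _ j])
  qed
qed (auto simp: compatible_def agrees_def edge_def)

section \<open>Adjacent exchanges and existence\<close>

text \<open>Only the terms at \<open>i\<close> and \<open>i + 1\<close> change. Exchanging an ascent
  lowers the sum and exchanging a descent raises it; both extremal arguments rest on this.\<close>

lemma sum_weighted_swap:
  fixes f :: "nat \<Rightarrow> real"
  assumes "1 \<le> i" "i < m"
  shows "(\<Sum>k\<in>{1..m}. real k * f (Transposition.transpose i (i + 1) k))
    = (\<Sum>k\<in>{1..m}. real k * f k) + f i - f (i + 1)"
proof -
  have split: "(\<Sum>k\<in>{1..m}. g k) = (\<Sum>k\<in>{1..m} - {i, i + 1}. g k) + g i + g (i + 1)"
    for g :: "nat \<Rightarrow> real"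
    using assms by (subst sum.subset_diff[of "{i, i + 1}"]) auto
  have "(\<Sum>k\<in>{1..m} - {i, i + 1}. real k * f (Transposition.transpose i (i + 1) k))
    = (\<Sum>k\<in>{1..m} - {i, i + 1}. real k * f k)"
    by (rule sum.cong) (auto simp: Transposition.transpose_def)
  then show ?thesis
    using split[of "\<lambda>k. real k * f (Transposition.transpose i (i + 1) k)"]
      split[of "\<lambda>k. real k * f k"]
    by (simp add: algebra_simps)
qed

lemma permutes_comp_swap:
  fixes i m :: nat
  assumes "\<pi> permutes {1..m}" "1 \<le> i" "i < m"
  shows "\<pi> \<circ> Transposition.transpose i (i + 1) permutes {1..m}"
  using assms by (intro permutes_compose permutes_swap_id) auto

lemma inv_comp_swap:
  assumes "\<pi> permutes S"
  shows "inv (\<pi> \<circ> Transposition.transpose i j) = Transposition.transpose i j \<circ> inv \<pi>"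
  using assms by (simp add: o_inv_distrib permutes_bij)

text \<open>A permutation maximising \<open>\<Sum>k. k * x (\<pi> k)\<close> sorts \<open>x\<close>.\<close>

lemma ex_sorting_permutation:
  fixes x :: "nat \<Rightarrow> real"
  shows "\<exists>\<pi>. \<pi> permutes {1..m} \<and>
    (\<forall>p q. 1 \<le> p \<longrightarrow> p \<le> q \<longrightarrow> q \<le> m \<longrightarrow> x (\<pi> p) \<le> x (\<pi> q))"
proof -
  define S where "S = {\<pi>. \<pi> permutes {1..m}}"
  define w where "w \<pi> = - (\<Sum>k\<in>{1..m}. real k * x (\<pi> k))" for \<pi>
  define \<pi> where "\<pi> = arg_min_on w S"
  have "finite S" "S \<noteq> {}"
    using permutes_id[of "{1..m}"] unfolding S_def by (simp add: finite_permutations, blast)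
  from arg_min_if_finite[OF this, of w]
  have perm: "\<pi> permutes {1..m}" and min: "\<And>\<sigma>. \<sigma> permutes {1..m} \<Longrightarrow> w \<pi> \<le> w \<sigma>"
    by (auto simp: S_def \<pi>_def not_less)
  have adj: "x (\<pi> i) \<le> x (\<pi> (i + 1))" if i: "1 \<le> i" "i < m" for i
    using min[OF permutes_comp_swap[OF perm i]] sum_weighted_swap[OF i, of "x \<circ> \<pi>"]
    by (simp add: w_def)
  have "x (\<pi> p) \<le> x (\<pi> q)" if "1 \<le> p" "p \<le> q" "q \<le> m" for p q
    using that(2,3)
  proof (induction q rule: dec_induct)
    case (step q)
    then show ?case
      using adj[of q] that(1) by simp
  qed simp
  then show ?thesis using perm by blast
qed

text \<open>Sort the indices by coordinate: the assumption excludes ties on edges, so weak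
  monotonicity decides every required comparison strictly.\<close>

lemma ex_agrees:
  assumes "\<And>i j. edge n i j \<Longrightarrow> x i \<noteq> x j"
  shows "\<exists>\<pi>. \<pi> permutes {1..2 * n} \<and> agrees n \<pi> x"
proof -
  obtain \<pi> where perm: "\<pi> permutes {1..2 * n}"
    and mono: "\<And>p q. 1 \<le> p \<Longrightarrow> p \<le> q \<Longrightarrow> q \<le> 2 * n \<Longrightarrow> x (\<pi> p) \<le> x (\<pi> q)"
    using ex_sorting_permutation[of "2 * n" x] by blast
  have "inv \<pi> i < inv \<pi> j \<longleftrightarrow> x i < x j" if e: "edge n i j" for i j
  proof -
    have ij: "i \<in> {1..2 * n}" "j \<in> {1..2 * n}" using e by (auto simp: edge_def)
    then have "inv \<pi> i \<in> {1..2 * n}" "inv \<pi> j \<in> {1..2 * n}"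
      using permutes_in_image[OF permutes_inv[OF perm]] by auto
    moreover have "\<pi> (inv \<pi> i) = i" "\<pi> (inv \<pi> j) = j"
      using permutes_inverses[OF perm] by auto
    ultimately have le: "inv \<pi> i \<le> inv \<pi> j \<Longrightarrow> x i \<le> x j" "inv \<pi> j \<le> inv \<pi> i \<Longrightarrow> x j \<le> x i"
      using mono[of "inv \<pi> i" "inv \<pi> j"] mono[of "inv \<pi> j" "inv \<pi> i"] by simp_all
    show ?thesis
    proof
      assume "inv \<pi> i < inv \<pi> j"
      then show "x i < x j" using le(1) assms[OF e] by linarith
    next
      assume "x i < x j"
      then show "inv \<pi> i < inv \<pi> j" using le(2) by linarith
    qed
  qed
  then show ?thesis using perm by (auto simp: agrees_def)
qed

text \<open>Only \<open>\<pi> i\<close> and \<open>\<pi> (i + 1)\<close> change their relative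
  order, and by \<open>bad\<close> they form no edge.\<close>

lemma agrees_swap:
  assumes perm: "\<pi> permutes S" and ag: "agrees n \<pi> x"
    and bad: "\<pi> i < \<pi> (i + 1)" "\<not> (odd (\<pi> i) \<and> even (\<pi> (i + 1)))"
  shows "agrees n (\<pi> \<circ> Transposition.transpose i (i + 1)) x"
  unfolding agrees_def
proof (intro allI impI)
  fix a b assume e: "edge n a b"
  have inv: "\<pi> (inv \<pi> a) = a" "\<pi> (inv \<pi> b) = b"
    using permutes_inverses[OF perm] by auto
  have "inv \<pi> a \<noteq> inv \<pi> b" using inv e by (auto simp: edge_def)
  moreover have "\<not> (inv \<pi> a = i \<and> inv \<pi> b = i + 1)" "\<not> (inv \<pi> a = i + 1 \<and> inv \<pi> b = i)"
    using inv e bad by (auto simp: edge_def)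
  ultimately have "Transposition.transpose i (i + 1) (inv \<pi> a)
      < Transposition.transpose i (i + 1) (inv \<pi> b) \<longleftrightarrow> inv \<pi> a < inv \<pi> b"
    by (auto simp: Transposition.transpose_def)
  then show "inv (\<pi> \<circ> Transposition.transpose i (i + 1)) a
      < inv (\<pi> \<circ> Transposition.transpose i (i + 1)) b \<longleftrightarrow> x a < x b"
    using ag e by (simp add: inv_comp_swap[OF perm] agrees_def)
qed

lemma ex_G_I_agrees:
  assumes "\<And>i j. edge n i j \<Longrightarrow> x i \<noteq> x j"
  shows "\<exists>\<pi>. \<pi> \<in> G_I n \<and> agrees n \<pi> x"
proof -
  define S where "S = {\<pi>. \<pi> permutes {1..2 * n} \<and> agrees n \<pi> x}"
  define w where "w \<pi> = (\<Sum>k\<in>{1..2 * n}. real k * real (\<pi> k))" for \<pi> :: "nat \<Rightarrow> nat"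
  define \<pi> where "\<pi> = arg_min_on w S"
  have "finite S"
    by (rule finite_subset[OF _ finite_permutations[of "{1..2 * n}"]]) (auto simp: S_def)
  moreover have "S \<noteq> {}" using ex_agrees[OF assms] by (auto simp: S_def)
  ultimately have perm: "\<pi> permutes {1..2 * n}" and ag: "agrees n \<pi> x"
    and min: "\<And>\<sigma>. \<sigma> permutes {1..2 * n} \<Longrightarrow> agrees n \<sigma> x \<Longrightarrow> w \<pi> \<le> w \<sigma>"
    using arg_min_if_finite[of S w] by (auto simp: S_def \<pi>_def not_less)
  have "odd (\<pi> i) \<and> even (\<pi> (i + 1))" if i: "1 \<le> i" "i < 2 * n" and asc: "\<pi> i < \<pi> (i + 1)" for i
  proof (rule ccontr)
    assume "\<not> (odd (\<pi> i) \<and> even (\<pi> (i + 1)))"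
    \<comment> \<open>The exchanged permutation still lies in \<open>S\<close>, but its weight is
      smaller by the positive number \<open>\<pi> (i + 1) - \<pi> i\<close>.\<close>
    then have "w \<pi> \<le> w (\<pi> \<circ> Transposition.transpose i (i + 1))"
      using min permutes_comp_swap[OF perm i] agrees_swap[OF perm ag asc] by blast
    then show False
      using asc sum_weighted_swap[OF i, of "\<lambda>k. real (\<pi> k)"] by (simp add: w_def)
  qed
  then show ?thesis using perm ag by (auto simp: G_I_def)
qed

section \<open>Uniqueness\<close>

text \<open>With \<open>\<sigma>\<close> an arbitrary agreeing permutation, this makes
  \<open>\<pi>\<close> the lexicographically largest one.\<close>

lemma G_I_agrees_first_difference:
  assumes \<pi>: "\<pi> \<in> G_I n" "agrees n \<pi> x" and \<sigma>: "\<sigma> permutes {1..2 * n}" "agrees n \<sigma> x"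
    and k: "1 \<le> k" "k \<le> 2 * n" and eq: "\<And>i. i < k \<Longrightarrow> \<pi> i = \<sigma> i"
  shows "\<sigma> k \<le> \<pi> k"
proof (rule ccontr)
  assume "\<not> \<sigma> k \<le> \<pi> k"
  define b m where "b = \<sigma> k" and "m = inv \<pi> b"
  have less: "\<pi> k < b" using \<open>\<not> \<sigma> k \<le> \<pi> k\<close> by (simp add: b_def)
  have perm: "\<pi> permutes {1..2 * n}" using \<pi>(1) by (simp add: G_I_def)
  note inv\<pi> = permutes_inverses[OF perm] and inv\<sigma> = permutes_inverses[OF \<sigma>(1)]
  have b: "b \<in> {1..2 * n}" using permutes_in_image[OF \<sigma>(1)] k by (simp add: b_def)
  then have m_in: "m \<in> {1..2 * n}"
    using permutes_in_image[OF permutes_inv[OF perm]] by (simp add: m_def)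
  have \<pi>m: "\<pi> m = b" by (simp add: m_def inv\<pi>)
  have "\<not> m < k"
  proof
    assume "m < k"
    then have "\<sigma> m = \<sigma> k" using eq[of m] \<pi>m by (simp add: b_def)
    then have "m = k" by (metis inv\<sigma>(2))
    then show False using \<open>m < k\<close> by simp
  qed
  then have km: "k < m" using less \<pi>m by (cases "m = k") auto
  \<comment> \<open>In \<open>\<pi>\<close> these letters precede \<open>b\<close>. In
    \<open>\<sigma>\<close> they follow it, because \<open>\<sigma>\<close> has \<open>b\<close> at
    \<open>k\<close> and the letters of \<open>\<pi>\<close> before \<open>k\<close>. An edge would
    force the same order in both.\<close>
  have no_edge: "\<not> edge n (\<pi> i) b \<and> \<not> edge n b (\<pi> i)" if i: "k \<le> i" "i < m" for i
  proof -
    have "inv \<sigma> b = k" by (simp add: b_def inv\<sigma>)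
    moreover have "inv \<sigma> (\<pi> i) \<noteq> k"
    proof
      assume "inv \<sigma> (\<pi> i) = k"
      then have "\<pi> i = b" using inv\<sigma>(1)[of "\<pi> i"] by (simp add: b_def)
      then show False using i inv\<pi>(2)[of i] by (simp add: m_def)
    qed
    moreover have "\<not> inv \<sigma> (\<pi> i) < k"
    proof
      assume less: "inv \<sigma> (\<pi> i) < k"
      then have "\<pi> (inv \<sigma> (\<pi> i)) = \<pi> i" using eq inv\<sigma>(1) by simp
      then have "inv \<sigma> (\<pi> i) = i" by (metis inv\<pi>(2))
      then show False using less i by simp
    qed
    ultimately have "inv \<sigma> b < inv \<sigma> (\<pi> i)" by simp
    moreover have "inv \<pi> (\<pi> i) < inv \<pi> b" using i by (simp add: inv\<pi> m_def)
    ultimately show ?thesis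
      using \<pi>(2) \<sigma>(2) unfolding agrees_def by (meson less_asym)
  qed
  \<comment> \<open>From position \<open>k\<close> to \<open>m\<close> the letters of
    \<open>\<pi>\<close> start below \<open>b\<close> and end at \<open>b\<close>, so some adjacent
    pair crosses \<open>b\<close>.\<close>
  obtain i where i: "k \<le> i" "i < m" "\<pi> i < b" "\<not> \<pi> (i + 1) < b"
  proof -
    have "\<exists>i\<ge>k. i < m \<and> \<pi> i < b \<and> \<not> \<pi> (Suc i) < b"
    proof (rule ccontr)
      assume none: "\<not> ?thesis"
      have "\<pi> i < b" if "k \<le> i" "i \<le> m" for i
        using that
      proof (induction i rule: dec_induct)
        case (step i)
        then have "i < m" "\<pi> i < b" by simp_all
        then show ?case using none step(1) by blast
      qed (use less in auto)
      from this[of m] show False using \<pi>m km by simp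
    qed
    then show thesis using that by auto
  qed
  have "i \<in> {1..<2 * n}" "\<pi> i < \<pi> (i + 1)" using i k m_in by auto
  then have "odd (\<pi> i)" "even (\<pi> (i + 1))"
    using \<pi>(1) by (simp_all add: G_I_def)
  moreover have "\<pi> i \<in> {1..2 * n}" "\<pi> (i + 1) \<in> {1..2 * n}"
    unfolding permutes_in_image[OF perm] using i k m_in by auto
  \<comment> \<open>An even \<open>b\<close> forms an edge with the smaller odd letter
    \<open>\<pi> i\<close>. An odd \<open>b\<close> differs from the even letter
    \<open>\<pi> (i + 1)\<close>, hence lies below it and forms an edge with it.\<close>
  ultimately have "edge n (\<pi> i) b \<or> \<pi> (i + 1) \<noteq> b \<and> edge n b (\<pi> (i + 1))"
    using i(3,4) b unfolding edge_def
    by (cases "even b") (auto simp: not_less intro: le_neq_implies_less)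
  \<comment> \<open>\<open>no_edge\<close> at \<open>i\<close> rules out the first alternative; in
    the second, \<open>i + 1 < m\<close>, so \<open>no_edge\<close> applies at \<open>i + 1\<close>
    too.\<close>
  then have "i + 1 \<noteq> m" "edge n b (\<pi> (i + 1))"
    using no_edge[OF i(1,2)] \<pi>m by blast+
  then show False
    using no_edge[of "i + 1"] i by simp
qed

lemma G_I_agrees_unique:
  assumes "\<pi> \<in> G_I n" "agrees n \<pi> x" "\<sigma> \<in> G_I n" "agrees n \<sigma> x"
  shows "\<pi> = \<sigma>"
proof
  fix k
  have perm: "\<pi> permutes {1..2 * n}" "\<sigma> permutes {1..2 * n}"
    using assms by (auto simp: G_I_def)
  show "\<pi> k = \<sigma> k"
  proof (induction k rule: less_induct)
    case (less k)
    show ?case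
    proof (cases "k \<in> {1..2 * n}")
      case True
      then have k: "1 \<le> k" "k \<le> 2 * n" by auto
      show ?thesis
      proof (rule antisym)
        show "\<sigma> k \<le> \<pi> k"
          by (rule G_I_agrees_first_difference[OF assms(1,2) perm(2) assms(4) k less.IH])
        show "\<pi> k \<le> \<sigma> k"
          by (rule G_I_agrees_first_difference[OF assms(3,4) perm(1) assms(2) k less.IH[symmetric]])
      qed
    next
      case False
      then show ?thesis using perm by (simp add: permutes_not_in)
    qed
  qed
qed

section \<open>Regions and sign patterns\<close>

definition chamber_space :: "nat \<Rightarrow> (nat \<Rightarrow> real) topology"
  where "chamber_space n = subtopology (ambient n) (topspace (ambient n) - \<Union> (arrangement n))"

lemma arrangement_eq: "arrangement n = {hyperplane n a b | a b. edge n a b}"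
proof -
  have "edge n (2 * i - 1) (2 * j)" if "1 \<le> i" "i \<le> j" "j \<le> n" for i j
    using that by (auto simp: edge_def)
  moreover have "\<exists>i j. a = 2 * i - 1 \<and> b = 2 * j \<and> 1 \<le> i \<and> i \<le> j \<and> j \<le> n"
    if e: "edge n a b" for a b
  proof -
    obtain i' j where "a = 2 * i' + 1" "b = 2 * j"
      using e by (auto simp: edge_def elim!: oddE evenE)
    \<comment> \<open>The shift in the witness comes from
      \<open>2 * i' + 1 = 2 * Suc i' - 1\<close>.\<close>
    then show ?thesis using e
      by (intro exI[of _ "Suc i'"] exI[of _ j]) (auto simp: edge_def)
  qed
  ultimately show ?thesis unfolding arrangement_def by blast
qed

lemma topspace_chamber_space:
  "topspace (chamber_space n)
    = {x \<in> extensional {1..2 * n + 1}. \<forall>a b. edge n a b \<longrightarrow> x a \<noteq> x b}"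
  by (auto simp: chamber_space_def arrangement_eq hyperplane_def ambient_def PiE_UNIV_domain
      PiE_def)

lemma continuous_map_chamber_space_coord:
  assumes "i \<in> {1..2 * n + 1}"
  shows "continuous_map (chamber_space n) euclideanreal (\<lambda>x. x i)"
  unfolding chamber_space_def ambient_def using assms
  by (intro continuous_map_from_subtopology continuous_map_product_projection)

lemma edge_in_range:
  assumes "edge n a b"
  shows "a \<in> {1..2 * n + 1}" "b \<in> {1..2 * n + 1}"
  using assms by (auto simp: edge_def)

text \<open>Intermediate values: the difference of the two coordinates has no zero on the
  complement, so it keeps its sign on a connected set.\<close>

lemma connected_component_of_imp_same_sign:
  assumes "connected_component_of (chamber_space n) x y" "edge n a b" "x a < x b"
  shows "y a < y b"
proof (rule ccontr)
  assume not: "\<not> y a < y b"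
  obtain T where T: "connectedin (chamber_space n) T" "x \<in> T" "y \<in> T"
    using assms(1) by (auto simp: connected_component_of_def)
  define g where "g = (\<lambda>z :: nat \<Rightarrow> real. z a - z b)"
  have "continuous_map (chamber_space n) euclideanreal g"
    unfolding g_def using edge_in_range[OF assms(2)]
    by (intro continuous_map_diff continuous_map_chamber_space_coord)
  then have "connectedin euclideanreal (g ` T)"
    using T(1) by (rule connectedin_continuous_map_image)
  then have "connected (g ` T)" by simp
  moreover have "g x \<in> g ` T" "g y \<in> g ` T" "g x \<le> 0" "0 \<le> g y"
    using T(2,3) assms(3) not by (auto simp: g_def)
  ultimately have "0 \<in> g ` T" by (meson connected_iff_interval)
  then obtain z where "z \<in> T" "z a = z b" by (auto simp: g_def)
  then show False
    using connectedin_subset_topspace[OF T(1)] assms(2) by (auto simp: topspace_chamber_space)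
qed

text \<open>Points with a common sign pattern form a convex set, so the segment from
  \<open>x\<close> to \<open>y\<close> avoids every hyperplane.\<close>

lemma same_sign_imp_connected_component_of:
  assumes x: "x \<in> topspace (chamber_space n)" and y: "y \<in> topspace (chamber_space n)"
    and sign: "\<And>a b. edge n a b \<Longrightarrow> x a < x b \<longleftrightarrow> y a < y b"
  shows "connected_component_of (chamber_space n) x y"
proof -
  \<comment> \<open>The restriction keeps \<open>h t\<close> extensional, as points of
    \<open>ambient n\<close> must be.\<close>
  define h where "h t = (\<lambda>i\<in>{1..2 * n + 1}. (1 - t) * x i + t * y i)" for t :: real
  have h_coord: "h t i = (1 - t) * x i + t * y i" if "i \<in> {1..2 * n + 1}" for t i
    using that by (simp add: h_def)
  have in_space: "h t \<in> topspace (chamber_space n)" if t: "t \<in> {0..1}" for t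
  proof -
    have "h t a \<noteq> h t b" if e: "edge n a b" for a b
    proof -
      have ne: "x a \<noteq> x b" "y a \<noteq> y b" using x y e by (auto simp: topspace_chamber_space)
      have conv: "(1 - t) * u + t * v < (1 - t) * u' + t * v'" if "u < u'" "v < v'"
        for u v u' v' :: real
      \<comment> \<open>Strictness comes from \<open>v < v'\<close> if \<open>t > 0\<close>, and
        from \<open>u < u'\<close> at the endpoint \<open>t = 0\<close>.\<close>
      proof (cases "t = 0")
        case False
        then have "t * v < t * v'" using t that by simp
        moreover have "(1 - t) * u \<le> (1 - t) * u'"
          using t that by (intro mult_left_mono) auto
        ultimately show ?thesis by simp
      qed (use that in simp)
      have "h t a < h t b \<or> h t b < h t a"
      proof (cases "x a < x b")
        case True
        then have "h t a < h t b"
          unfolding h_coord[OF edge_in_range(1)[OF e]] h_coord[OF edge_in_range(2)[OF e]]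
          using sign[OF e] by (intro conv) auto
        then show ?thesis ..
      next
        case False
        then have "h t b < h t a"
          unfolding h_coord[OF edge_in_range(1)[OF e]] h_coord[OF edge_in_range(2)[OF e]]
          using sign[OF e] ne by (intro conv) auto
        then show ?thesis ..
      qed
      then show ?thesis by auto
    qed
    then show ?thesis by (simp add: topspace_chamber_space h_def)
  qed
  have "continuous_map (top_of_set {0..1}) euclideanreal (\<lambda>t. h t i)"
    if "i \<in> {1..2 * n + 1}" for i
    unfolding h_coord[OF that] continuous_map_iff_continuous by (intro continuous_intros)
  moreover have "h ` topspace (top_of_set {0..1}) \<subseteq> extensional {1..2 * n + 1}"
    by (auto simp: h_def)
  ultimately have "continuous_map (top_of_set {0..1}) (ambient n) h"
    unfolding ambient_def continuous_map_componentwise by blast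
  then have "continuous_map (top_of_set {0..1}) (chamber_space n) h"
    using in_space unfolding chamber_space_def
    by (auto simp: continuous_map_in_subtopology)
  moreover have "connectedin (top_of_set {0..1}) {0..1 :: real}"
    by (simp add: connectedin_subtopology)
  ultimately have "connectedin (chamber_space n) (h ` {0..1})"
    by (rule connectedin_continuous_map_image)
  moreover have "h 0 = x" "h 1 = y"
    using x y by (auto simp: h_def topspace_chamber_space extensional_restrict)
  then have "x \<in> h ` {0..1}" "y \<in> h ` {0..1}"
    by (metis atLeastAtMost_iff imageI order_refl zero_le_one)+
  ultimately show ?thesis by (auto simp: connected_component_of_def)
qed

lemma regions_eq:
  "regions n = connected_component_of_set (chamber_space n) ` topspace (chamber_space n)"
  by (simp add: regions_def chamber_space_def connected_components_of_def)

text \<open>Agreement depends only on the sign pattern, which is constant on a component.\<close>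

lemma compatible_region_iff:
  assumes "x \<in> topspace (chamber_space n)"
  shows "compatible n \<pi> (connected_component_of_set (chamber_space n) x) \<longleftrightarrow> agrees n \<pi> x"
proof -
  have "agrees n \<pi> y"
    if "agrees n \<pi> x" and y: "connected_component_of (chamber_space n) x y" for y
  proof -
    have "connected_component_of (chamber_space n) y x"
      using y by (simp add: connected_component_of_sym)
    then have "x a < x b \<longleftrightarrow> y a < y b" if "edge n a b" for a b
      using connected_component_of_imp_same_sign that y by blast
    then show ?thesis using that(1) by (simp add: agrees_def)
  qed
  moreover have "connected_component_of (chamber_space n) x x"
    using assms by (simp add: connected_component_of_refl)
  ultimately show ?thesis by (auto simp: compatible_iff_agrees)
qed

section \<open>The bijection\<close>

lemma ex1_compatible:
  assumes "R \<in> regions n"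
  shows "\<exists>!\<pi>. \<pi> \<in> G_I n \<and> compatible n \<pi> R"
proof -
  obtain x where x: "x \<in> topspace (chamber_space n)"
    and R: "R = connected_component_of_set (chamber_space n) x"
    using assms by (auto simp: regions_eq)
  have "\<exists>\<pi>. \<pi> \<in> G_I n \<and> agrees n \<pi> x"
    using x by (intro ex_G_I_agrees) (auto simp: topspace_chamber_space)
  then show ?thesis
    unfolding R compatible_region_iff[OF x] using G_I_agrees_unique by blast
qed

text \<open>Agreement with \<open>\<pi>\<close> fixes the sign pattern of a point and hence its
  component.\<close>

lemma compatible_region_inj:
  assumes "R \<in> regions n" "S \<in> regions n" "compatible n \<pi> R" "compatible n \<pi> S"
  shows "R = S"
proof -
  obtain x y where x: "x \<in> topspace (chamber_space n)" and y: "y \<in> topspace (chamber_space n)"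
    and R: "R = connected_component_of_set (chamber_space n) x"
    and S: "S = connected_component_of_set (chamber_space n) y"
    using assms(1,2) by (auto simp: regions_eq)
  have "agrees n \<pi> x" "agrees n \<pi> y"
    using assms(3,4) by (simp_all add: R S compatible_region_iff x y)
  then have "connected_component_of (chamber_space n) x y"
    by (intro same_sign_imp_connected_component_of x y) (auto simp: agrees_def)
  then show ?thesis by (simp add: R S connected_component_of_equiv)
qed

lemma ex_region_compatible:
  assumes "\<pi> \<in> G_I n"
  shows "\<exists>R\<in>regions n. compatible n \<pi> R"
proof -
  \<comment> \<open>The coordinate at a letter is its position in \<open>\<pi>\<close>: agreement is
    then immediate, and distinct positions keep \<open>x\<close> off the hyperplanes.\<close>
  define x where "x = (\<lambda>i\<in>{1..2 * n + 1}. real (inv \<pi> i))"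
  have perm: "\<pi> permutes {1..2 * n}" using assms by (simp add: G_I_def)
  have x_coord: "x a = real (inv \<pi> a)" "x b = real (inv \<pi> b)" if "edge n a b" for a b
    using edge_in_range[OF that] by (simp_all add: x_def)
  have "x a \<noteq> x b" if "edge n a b" for a b
    using that x_coord[OF that] permutes_inverses(1)[OF perm]
    by (metis edge_def less_irrefl of_nat_eq_iff)
  then have x: "x \<in> topspace (chamber_space n)"
    by (simp add: topspace_chamber_space x_def)
  have "agrees n \<pi> x" by (simp add: agrees_def x_coord)
  then show ?thesis
    using x by (auto simp: regions_eq compatible_region_iff)
qed

theorem theorem1p4:
  fixes n :: nat
  assumes "n \<ge> 1"
  shows "(\<forall>R\<in>regions n. \<exists>!\<pi>. \<pi> \<in> G_I n \<and> compatible n \<pi> R)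
    \<and> bij_betw (Lambda_I n) (regions n) (G_I n)
    \<and> regions n \<approx> G_I n"
proof -
  have Lambda: "Lambda_I n R \<in> G_I n" "compatible n (Lambda_I n R) R" if "R \<in> regions n" for R
    using theI'[OF ex1_compatible[OF that]] by (simp_all add: Lambda_I_def)
  have "inj_on (Lambda_I n) (regions n)"
    using Lambda(2) compatible_region_inj by (intro inj_onI) metis
  moreover have "\<pi> \<in> Lambda_I n ` regions n" if \<pi>: "\<pi> \<in> G_I n" for \<pi>
  proof -
    obtain R where R: "R \<in> regions n" "compatible n \<pi> R"
      using ex_region_compatible[OF \<pi>] by blast
    \<comment> \<open>Both permutations lie in \<open>G_I n\<close> and are compatible with
      \<open>R\<close>.\<close>
    then have "\<pi> = Lambda_I n R" using \<pi> Lambda ex1_compatible by blast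
    then show ?thesis using R(1) by blast
  qed
  ultimately have "bij_betw (Lambda_I n) (regions n) (G_I n)"
    using Lambda(1) unfolding bij_betw_def by blast
  then show ?thesis using ex1_compatible by (auto simp: eqpoll_def)
qed

end
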